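(* For every $\varepsilon>0$ there is a constant $C_\varepsilon>0$ such that for every positive integer $N$, every positive integer $q$, every integer $a$ and every Sidon set $S\subset[N]$ with $|S|\geq \frac{1}{100}N^{1/2}$, $$\left|\mathbb{E}_{x\in S}1_{q\cdot\mathbb{Z}+a}(x)-q^{-1}\right|\leq C_\varepsilon N^{\varepsilon}\left(\left|\frac{|S|}{N^{1/2}}-1\right|+N^{-1/6}\right)^{1/2}.$$
   Context: $[N]=\{1,2,\dots,N\}$. A set $S\subset\mathbb{Z}$ is Sidon if every non-zero integer $x$ has at most one representation $x=s_1-s_2$ with $s_1,s_2\in S$. For a finite non-empty set $S$, $\mathbb{E}_{x\in S}f(x)=\frac{1}{|S|}\sum_{x\in S}f(x)$. $q\cdot\mathbb{Z}+a=\{qn+a:n\in\mathbb{Z}\}$, and $1_A$ is the indicator function of $A$. *)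

theory Defs
  imports Complex_Main "HOL-Library.Indicator_Function"
begin

definition sidon :: "int set \<Rightarrow> bool" where
  "sidon S \<longleftrightarrow> (\<forall>x. x \<noteq> 0 \<longrightarrow> (\<exists>\<^sub>\<le>\<^sub>1 p. p \<in> S \<times> S \<and> x = fst p - snd p))"

(* Meaningful only for finite non-empty S. *)
definition expect :: "'a set \<Rightarrow> ('a \<Rightarrow> real) \<Rightarrow> real" where
  "expect S f = 1 / real (card S) * (\<Sum>x\<in>S. f x)"

definition arith_prog :: "int \<Rightarrow> int \<Rightarrow> int set" where
  "arith_prog q a = {q * n + a | n. n \<in> UNIV}"

end

theory Submission
  imports Defs "HOL-Analysis.Convex"
begin

text \<open>
  The Erdos--Turan window argument, run along progressions of step \<open>q\<close>. Let
  \<open>f u\<close> be the number of elements of \<open>S\<close> in the window \<open>{u + q h | h < H}\<close>. The Sidon property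
  bounds the second moment of \<open>f\<close> by \<open>H |S| + H^2\<close>, so \<open>f\<close> has small variance when \<open>|S|\<close> is close
  to \<open>N^(1/2)\<close>. Each window lies in a single residue class modulo \<open>q\<close>; summing the deviation of \<open>f\<close>
  over one class and applying Cauchy--Schwarz bounds the discrepancy of \<open>S\<close> on that class.
  Taking \<open>H\<close> close to \<open>N^(3/4)\<close> gives the error \<open>(| |S| / N^(1/2) - 1 | + N^(-1/4))^(1/2)\<close>.
\<close>

section \<open>Residue classes and differences in Sidon sets\<close>

lemma mem_arith_prog_iff: "x \<in> arith_prog q a \<longleftrightarrow> q dvd x - a"
  by (auto simp: arith_prog_def dvd_def algebra_simps)

lemma sidon_eq:
  assumes "sidon S" "s \<in> S" "t \<in> S" "s' \<in> S" "t' \<in> S" "s - t = s' - t'" "s \<noteq> t"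
  shows "s = s'"
proof -
  have "\<exists>\<^sub>\<le>\<^sub>1 p. p \<in> S \<times> S \<and> s - t = fst p - snd p"
    using assms(1,7) unfolding sidon_def by auto
  then have "(s, t) = (s', t')"
    by (rule Uniq_D) (use assms(2-6) in simp_all)
  then show ?thesis by simp
qed

lemma card_interval_inter_arith_prog:
  fixes q K :: nat and a b :: int
  assumes "q > 0"
  shows "card ({b..<b + int q * int K} \<inter> arith_prog (int q) a) = K"
proof -
  \<comment> \<open>\<open>b + r\<close> is the least element of the class that is at least
    \<open>b\<close>. As the interval has length \<open>q K\<close>, the class meets it exactly in
    the points \<open>b + r + q j\<close> with \<open>j < K\<close>.\<close>
  define r where "r = (a - b) mod int q"
  have r: "0 \<le> r" "r < int q" using assms by (auto simp: r_def)
  have ra: "int q dvd b + r - a"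
    by (metis r_def add.commute diff_diff_eq2 dvd_minus_mod dvd_minus_iff minus_diff_eq)
  have "bij_betw (\<lambda>j. b + r + int q * int j) {..<K}
      ({b..<b + int q * int K} \<inter> arith_prog (int q) a)"
  proof (rule bij_betw_imageI)
    show "inj_on (\<lambda>j. b + r + int q * int j) {..<K}"
      using assms by (auto intro!: inj_onI)
    show "(\<lambda>j. b + r + int q * int j) ` {..<K} = {b..<b + int q * int K} \<inter> arith_prog (int q) a"
    proof (intro equalityI subsetI)
      fix x assume "x \<in> (\<lambda>j. b + r + int q * int j) ` {..<K}"
      then obtain j where j: "j < K" "x = b + r + int q * int j" by auto
      have "int q * (int j + 1) \<le> int q * int K"
        using j by (intro mult_left_mono) auto
      then have "x < b + int q * int K" using j r by (simp add: algebra_simps)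
      moreover have "b \<le> x" using j r by simp
      moreover have "int q dvd (b + r - a) + int q * int j" using ra by simp
      ultimately show "x \<in> {b..<b + int q * int K} \<inter> arith_prog (int q) a"
        using j by (simp add: mem_arith_prog_iff algebra_simps)
    next
      fix x assume x: "x \<in> {b..<b + int q * int K} \<inter> arith_prog (int q) a"
      then have "int q dvd (x - a) - (b + r - a)"
        using dvd_diff[OF _ ra, of "x - a"] by (simp only: mem_arith_prog_iff Int_iff)
      then obtain j where j: "x - b - r = int q * j" by (auto simp: dvd_def algebra_simps)
      \<comment> \<open>\<open>x \<ge> b\<close> and \<open>r < q\<close> give
        \<open>q j > - q\<close>, which over the integers forces \<open>j \<ge> 0\<close>.\<close>
      have "int q * (-1) < int q * j" using j r x by auto
      then have "j \<ge> 0" using assms by (simp only: mult_less_cancel_left_pos of_nat_0_less_iff)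
      moreover have "int q * j < int q * int K"
        using j r x unfolding Int_iff atLeastLessThan_iff by linarith
      then have "j < int K" using assms by (simp only: mult_less_cancel_left_pos of_nat_0_less_iff)
      ultimately show "x \<in> (\<lambda>j. b + r + int q * int j) ` {..<K}"
        using j by (intro image_eqI[of _ _ "nat j"]) auto
    qed
  qed
  then show ?thesis using bij_betw_same_card by fastforce
qed

section \<open>First and second moments of the window counts\<close>

context
  fixes S :: "int set" and q H :: nat
begin

definition window_count :: "int \<Rightarrow> real" where
  "window_count u = (\<Sum>h<H. of_bool (u + int q * int h \<in> S))"

text \<open>Double counting: for each fixed \<open>h\<close>, translation by \<open>q h\<close>
  matches the starts \<open>u\<close> that contribute with the elements of
  \<open>S \<inter> X\<close>. The inverse translation uses \<open>- h\<close>, hence the invariance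
  of \<open>X\<close> under integer multiples of \<open>q\<close>. It serves both for a residue
  class and for \<open>X = UNIV\<close>.\<close>

lemma sum_window_count:
  fixes U X :: "int set"
  assumes "finite U" and U: "\<And>s h. s \<in> S \<Longrightarrow> h < H \<Longrightarrow> s - int q * int h \<in> U"
    and X: "\<And>u h :: int. u + int q * h \<in> X \<longleftrightarrow> u \<in> X"
  shows "(\<Sum>u\<in>U \<inter> X. window_count u) = real H * real (card (S \<inter> X))"
proof -
  have "(\<Sum>u\<in>U \<inter> X. of_bool (u + int q * int h \<in> S)) = real (card (S \<inter> X))" if "h < H" for h
  proof -
    have "bij_betw (\<lambda>u. u + int q * int h) ((U \<inter> X) \<inter> {u. u + int q * int h \<in> S}) (S \<inter> X)"
      by (rule bij_betw_byWitness[where f' = "\<lambda>s. s - int q * int h"])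
        (use U X[of _ "int h"] X[of _ "- int h"] that in auto)
    then show ?thesis
      using assms(1) by (simp add: bij_betw_same_card sum_of_bool_eq)
  qed
  then have "(\<Sum>h<H. \<Sum>u\<in>U \<inter> X. of_bool (u + int q * int h \<in> S)) = real H * real (card (S \<inter> X))"
    by simp
  then show ?thesis unfolding window_count_def by (subst sum.swap)
qed

text \<open>Expanding the square counts triples \<open>u, h, k\<close> whose two points
  \<open>u + q h\<close> and \<open>u + q k\<close> lie in \<open>S\<close>. For
  \<open>h \<noteq> k\<close> these have the fixed non-zero difference \<open>q (h - k)\<close>, so
  at most one \<open>u\<close> survives; for \<open>h = k\<close> at most \<open>card S\<close>
  do.\<close>

lemma sum_window_count_sq_le:
  assumes "sidon S" "finite S" "q > 0" "finite U"
  shows "(\<Sum>u\<in>U. (window_count u)\<^sup>2) \<le> real H * real (card S) + (real H)\<^sup>2"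
proof -
  define P where "P h k = {u \<in> U. u + int q * int h \<in> S \<and> u + int q * int k \<in> S}" for h k
  have diag: "card (P h h) \<le> card S" for h
    by (rule card_inj_on_le[where f = "\<lambda>u. u + int q * int h"])
      (use assms in \<open>auto simp: P_def intro: inj_onI\<close>)
  have off: "card (P h k) \<le> 1" if "h \<noteq> k" for h k
  proof -
    have "u = v" if uv: "u \<in> P h k" "v \<in> P h k" for u v
    proof -
      have "u + int q * int h = v + int q * int h"
        by (rule sidon_eq[OF assms(1), where t = "u + int q * int k" and t' = "v + int q * int k"])
          (use uv \<open>h \<noteq> k\<close> \<open>q > 0\<close> in \<open>auto simp: P_def\<close>)
      then show ?thesis by simp
    qed
    then show ?thesis using assms(4) by (auto simp: P_def card_le_Suc0_iff_eq)
  qed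
  \<comment> \<open>Keeping the \<open>1\<close> on the diagonal as well costs only \<open>H\<close>
    in total and makes the double sum a clean \<open>H^2 + H |S|\<close>.\<close>
  have bound: "real (card (P h k)) \<le> 1 + (if h = k then real (card S) else 0)" for h k
    using diag[of h] off[of h k] by auto
  have "(\<Sum>u\<in>U. (window_count u)\<^sup>2)
      = (\<Sum>u\<in>U. \<Sum>h<H. \<Sum>k<H. of_bool (u + int q * int h \<in> S \<and> u + int q * int k \<in> S))"
    by (simp only: window_count_def power2_eq_square sum_product of_bool_conj)
  also have "\<dots> = (\<Sum>h<H. \<Sum>k<H. \<Sum>u\<in>U. of_bool (u + int q * int h \<in> S \<and> u + int q * int k \<in> S))"
    by (subst sum.swap, rule sum.cong[OF refl], rule sum.swap)
  also have "\<dots> = (\<Sum>h<H. \<Sum>k<H. real (card (P h k)))"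
    using assms(4) by (simp add: P_def sum_of_bool_eq Int_def)
  also have "\<dots> \<le> (\<Sum>h<H. \<Sum>k<H. 1 + (if h = k then real (card S) else 0))"
    by (intro sum_mono bound)
  also have "\<dots> = real H * real (card S) + (real H)\<^sup>2"
    by (simp add: sum.distrib power2_eq_square distrib_left)
  finally show ?thesis .
qed

end

section \<open>From moments to discrepancy, and the choice of window length\<close>

text \<open>The squared deviations of \<open>f\<close> from its mean over all of \<open>U\<close>
  dominate those over one residue class, where Cauchy--Schwarz involves only about
  \<open>1 / q\<close> of the starts. \<open>H\<close> stays free, to be optimised later.\<close>

lemma sidon_arith_prog_discrepancy:
  fixes S :: "int set" and N q H :: nat and a :: int
  assumes S: "sidon S" "S \<subseteq> {1..int N}" and "q > 0" "H > 0"
  shows "(real (card (S \<inter> arith_prog (int q) a)) - real (card S) / real q)\<^sup>2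
    \<le> (real H + real (N div q) + 1) * (1 + real (card S) / real H) - (real (card S))\<^sup>2 / real q"
proof -
  \<comment> \<open>\<open>K\<close> is the number of starts per class: \<open>H\<close> of them
    allow for windows starting to the left of \<open>1\<close>, and
    \<open>q (N div q + 1) > N\<close> covers the rest of \<open>S\<close>.\<close>
  define K where "K = H + N div q + 1"
  define U where "U = {- (int q * int H)..<- (int q * int H) + int q * int K}"
  define A where "A = U \<inter> arith_prog (int q) a"
  define f where "f = window_count S q H"
  define s where "s = real (card S)"
  define n where "n = real (card (S \<inter> arith_prog (int q) a))"
  \<comment> \<open>The mean of \<open>f\<close> over \<open>U\<close>, with total
    \<open>H s\<close> and \<open>q K\<close> starts.\<close>
  define c where "c = real H * s / (real q * real K)"
  have K: "real K > 0" by (simp add: K_def)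
  have finS: "finite S" using S(2) finite_subset by blast
  have fin: "finite U" "finite A" by (auto simp: U_def A_def)
  have "N < q * (N div q + 1)"
    using \<open>q > 0\<close> by (simp add: dividend_less_times_div)
  then have N: "int N < int q * int (N div q + 1)"
    by (metis of_nat_less_iff of_nat_mult)
  have shift: "t - int q * int h \<in> U" if "t \<in> S" "h < H" for t h
  proof -
    have "int q * int h \<le> int q * int H" using that by (intro mult_left_mono) auto
    moreover have "1 \<le> t" "t \<le> int N" using S(2) that by auto
    moreover have "0 \<le> int q * int h" by simp
    moreover have "- (int q * int H) + int q * int K = int q * int (N div q + 1)"
      by (simp add: K_def algebra_simps)
    ultimately show ?thesis using N unfolding U_def atLeastLessThan_iff by linarith
  qed
  have invariant: "u + int q * h \<in> arith_prog (int q) a \<longleftrightarrow> u \<in> arith_prog (int q) a" for u h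
    using dvd_add_left_iff[of "int q" "int q * h" "u - a"]
    by (simp add: mem_arith_prog_iff add_diff_eq diff_add_eq)
  have sumA: "(\<Sum>u\<in>A. f u) = real H * n"
    unfolding A_def f_def n_def
    by (rule sum_window_count[OF fin(1) shift invariant])
  have sumU: "(\<Sum>u\<in>U. f u) = real H * s"
    using sum_window_count[where X = UNIV, OF fin(1) shift] by (simp add: f_def s_def)
  have cardA: "card A = K"
    unfolding A_def U_def by (rule card_interval_inter_arith_prog[OF \<open>q > 0\<close>])
  have cardU: "real (card U) = real q * real K"
    by (simp add: U_def nat_mult_distrib)
  have "(\<Sum>u\<in>A. f u - c) = real H * n - real K * c"
    by (simp add: sum_subtractf sumA cardA)
  also have "\<dots> = real H * (n - s / real q)"
    using K by (simp add: c_def algebra_simps)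
  finally have "(real H)\<^sup>2 * (n - s / real q)\<^sup>2 = (\<Sum>u\<in>A. f u - c)\<^sup>2"
    by (simp add: power_mult_distrib)
  also have "\<dots> \<le> real K * (\<Sum>u\<in>A. (f u - c)\<^sup>2)"
    using sum_squared_le_sum_of_squares[of "\<lambda>u. f u - c" A] cardA by (simp add: mult.commute)
  also have "\<dots> \<le> real K * (\<Sum>u\<in>U. (f u - c)\<^sup>2)"
    using fin by (intro mult_left_mono sum_mono2) (auto simp: A_def)
  also have "(\<Sum>u\<in>U. (f u - c)\<^sup>2) = (\<Sum>u\<in>U. (f u)\<^sup>2) - 2 * c * (\<Sum>u\<in>U. f u) + real (card U) * c\<^sup>2"
    by (simp add: power2_diff sum.distrib sum_subtractf sum_distrib_left sum_distrib_right mult_ac)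
  \<comment> \<open>Since \<open>c\<close> is the mean, the cross term and the constant term combine
    to minus the square of the total over the number of starts.\<close>
  also have "\<dots> = (\<Sum>u\<in>U. (f u)\<^sup>2) - (real H * s)\<^sup>2 / (real q * real K)"
    using K \<open>q > 0\<close> by (simp add: sumU cardU c_def power2_eq_square field_simps)
  also have "real K * \<dots> \<le> real K * ((real H * s + (real H)\<^sup>2) - (real H * s)\<^sup>2 / (real q * real K))"
    using sum_window_count_sq_le[OF S(1) finS \<open>q > 0\<close> fin(1), of H]
    by (intro mult_left_mono diff_right_mono) (auto simp: f_def s_def)
  also have "\<dots> = (real H)\<^sup>2 * (real K * (1 + s / real H) - s\<^sup>2 / real q)"
    using K \<open>q > 0\<close> \<open>H > 0\<close> by (simp add: power2_eq_square field_simps)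
  finally have "(n - s / real q)\<^sup>2 \<le> real K * (1 + s / real H) - s\<^sup>2 / real q"
    using \<open>H > 0\<close> by simp
  then show ?thesis by (simp add: K_def n_def s_def add_ac)
qed

lemma sidon_equidistribution:
  fixes S :: "int set" and N q :: nat and a :: int
  assumes S: "sidon S" "S \<subseteq> {1..int N}" and pos: "N > 0" "q > 0"
    and lower: "real (card S) \<ge> 1 / 100 * real N powr (1/2)"
  shows "\<bar>real (card (S \<inter> arith_prog (int q) a)) / real (card S) - 1 / real q\<bar>
    \<le> 300 * sqrt (\<bar>real (card S) / real N powr (1/2) - 1\<bar> + real N powr (-1/4))"
proof -
  define t where "t = real N powr (1/4)"
  define s where "s = real (card S)"
  define n where "n = real (card (S \<inter> arith_prog (int q) a))"
  define \<delta> where "\<delta> = \<bar>s / t\<^sup>2 - 1\<bar>"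
  have t: "t \<ge> 1" using pos by (simp add: t_def ge_one_powr_ge_zero)
  have r: "real N powr (1/2) = t\<^sup>2"
    using pos by (simp add: t_def powr_power)
  have N: "real N = t ^ 4"
    using pos by (simp add: t_def powr_power)
  have ti: "real N powr (-1/4) = 1 / t"
    using powr_minus[of "real N" "1/4"] by (simp add: t_def field_simps)
  have s_lower: "s \<ge> t\<^sup>2 / 100" using lower by (simp add: r s_def)
  have "t\<^sup>2 \<ge> 1" using t by simp
  then have s: "s > 0" using s_lower by linarith
  have finS: "finite S" using S(2) finite_subset by blast
  have "\<bar>n / s - 1 / real q\<bar> \<le> 300 * sqrt (\<delta> + 1 / t)"
  \<comment> \<open>For \<open>\<delta> \<ge> 1\<close> the claim is trivial, as both densities lie
    in \<open>[0, 1]\<close>; otherwise \<open>s\<close> is at most \<open>2 t^2\<close>.\<close>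
  proof (cases "\<delta> \<ge> 1")
    case True
    have "n \<le> s" using finS by (auto simp: n_def s_def intro!: card_mono)
    then have "0 \<le> n / s" "n / s \<le> 1" using s by (auto simp: n_def)
    moreover have "0 \<le> 1 / real q" "1 / real q \<le> 1" using pos by auto
    ultimately have "\<bar>n / s - 1 / real q\<bar> \<le> 1" by linarith
    moreover have "1 / t \<ge> 0" using t by simp
    then have "sqrt (\<delta> + 1 / t) \<ge> 1" using True by (intro real_sqrt_ge_one) linarith
    ultimately show ?thesis by linarith
  next
    case False
    then have s_upper: "s \<le> 2 * t\<^sup>2" using t by (auto simp: \<delta>_def field_simps abs_if split: if_splits)
    have var: "t ^ 4 - s\<^sup>2 \<le> 3 * \<delta> * t ^ 4"
    proof -
      have "t\<^sup>2 - s \<le> \<delta> * t\<^sup>2"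
      proof -
        have "(1 - s / t\<^sup>2) * t\<^sup>2 \<le> \<delta> * t\<^sup>2"
          by (intro mult_right_mono) (auto simp: \<delta>_def)
        then show ?thesis using t by (simp add: left_diff_distrib)
      qed
      then have "(t\<^sup>2 - s) * (t\<^sup>2 + s) \<le> (\<delta> * t\<^sup>2) * (t\<^sup>2 + s)"
        using s by (intro mult_right_mono) auto
      also have "\<dots> \<le> (\<delta> * t\<^sup>2) * (3 * t\<^sup>2)"
        using s_upper by (intro mult_left_mono) (auto simp: \<delta>_def)
      finally show ?thesis by (simp add: power2_eq_square power4_eq_xxxx algebra_simps)
    qed
    \<comment> \<open>This length balances the error \<open>H\<close> against
      \<open>t^4 s / H\<close>: with \<open>s\<close> of order \<open>t^2\<close>, both have order
      \<open>t^3\<close>.\<close>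
    define H where "H = nat \<lceil>t ^ 3\<rceil>"
    have t3: "t ^ 3 \<ge> 1" "t\<^sup>2 \<le> t ^ 3"
      using t by (auto intro: power_increasing)
    have H: "t ^ 3 \<le> real H" "real H \<le> t ^ 3 + 1"
      unfolding H_def using t3(1) by linarith+
    have "H > 0" using H(1) t3(1) by linarith
    have sH: "s / real H \<le> 2 / t"
    proof -
      have "s / real H \<le> (2 * t\<^sup>2) / t ^ 3"
        using s_upper H t t3 s by (intro frac_le) auto
      then show ?thesis using t by (simp add: power2_eq_square power3_eq_cube)
    qed
    have "(n - s / real q)\<^sup>2 \<le> (real H + real (N div q) + 1) * (1 + s / real H) - s\<^sup>2 / real q"
      unfolding n_def s_def by (rule sidon_arith_prog_discrepancy) fact+
    also have "\<dots> \<le> (real H + t ^ 4 / real q + 1) * (1 + s / real H) - s\<^sup>2 / real q"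
      using of_nat_div_le_of_nat[of N q, where 'a = real] s by (intro diff_right_mono mult_right_mono) (auto simp: N)
    also have "\<dots> = real H + s + 1 + s / real H + t ^ 4 * (s / real H) / real q + (t ^ 4 - s\<^sup>2) / real q"
      using \<open>H > 0\<close> pos(2) by (simp add: field_simps)
    \<comment> \<open>Dropping the division by \<open>q\<close> requires a non-negative numerator.
      As \<open>t^4 - s^2\<close> may be negative, it is first replaced by its bound
      \<open>3 \<delta> t^4\<close>.\<close>
    also have "\<dots> \<le> real H + s + 1 + s / real H + t ^ 4 * (s / real H) + 3 * \<delta> * t ^ 4"
    proof -
      have "x / real q \<le> x" if "x \<ge> 0" for x :: real
        using pos that by (auto simp: divide_le_eq mult_le_cancel_left1)
      moreover have "(t ^ 4 - s\<^sup>2) / real q \<le> 3 * \<delta> * t ^ 4 / real q"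
        using var by (intro divide_right_mono) auto
      moreover have "t ^ 4 * (s / real H) \<ge> 0" "3 * \<delta> * t ^ 4 \<ge> 0"
        using s by (auto simp: \<delta>_def)
      ultimately show ?thesis by (smt (verit))
    qed
    also have "\<dots> \<le> (t ^ 3 + 1) + 2 * t ^ 3 + 1 + 2 + 2 * t ^ 3 + 3 * \<delta> * t ^ 4"
    proof -
      have "t ^ 4 * (s / real H) \<le> t ^ 4 * (2 / t)" using sH by (intro mult_left_mono) auto
      also have "\<dots> = 2 * t ^ 3" using t by (simp add: power4_eq_xxxx power3_eq_cube)
      finally have "t ^ 4 * (s / real H) \<le> 2 * t ^ 3" .
      moreover have "2 / t \<le> 2" using t by (simp add: divide_le_eq)
      ultimately show ?thesis using H sH s_upper t3 by linarith
    qed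
    \<comment> \<open>The left side is \<open>5 t^3 + 4 + 3 \<delta> t^4\<close> and
      \<open>t \<ge> 1\<close>; the coefficient of \<open>\<delta>\<close> is raised to
      \<open>9\<close> to obtain a common factor.\<close>
    also have "\<dots> \<le> 9 * t ^ 3 + 9 * \<delta> * t ^ 4"
    proof -
      have "0 \<le> \<delta> * t ^ 4" by (simp add: \<delta>_def)
      then show ?thesis using t3 by linarith
    qed
    also have "\<dots> = 9 * t ^ 4 * (\<delta> + 1 / t)"
      using t by (simp add: field_simps power4_eq_xxxx power3_eq_cube)
    \<comment> \<open>The lower bound on \<open>|S|\<close> enters here, and
      \<open>9 * 10000 = 300^2\<close> is the source of the constant \<open>300\<close>.\<close>
    also have "\<dots> \<le> 9 * (10000 * s\<^sup>2) * (\<delta> + 1 / t)"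
    proof -
      have "(t\<^sup>2)\<^sup>2 \<le> (100 * s)\<^sup>2" using s_lower by (intro power_mono) auto
      then have "t ^ 4 \<le> 10000 * s\<^sup>2" by (simp add: power_mult_distrib flip: power_mult)
      then show ?thesis using t by (intro mult_right_mono mult_left_mono) (auto simp: \<delta>_def)
    qed
    finally have "(n - s / real q)\<^sup>2 \<le> (300 * s)\<^sup>2 * (\<delta> + 1 / t)"
      by (simp add: power_mult_distrib)
    then have "sqrt ((n - s / real q)\<^sup>2) \<le> sqrt ((300 * s)\<^sup>2 * (\<delta> + 1 / t))"
      by (rule real_sqrt_le_mono)
    then have "\<bar>n - s / real q\<bar> \<le> \<bar>300 * s\<bar> * sqrt (\<delta> + 1 / t)"
      unfolding real_sqrt_mult real_sqrt_abs .
    then have "\<bar>n - s / real q\<bar> \<le> 300 * sqrt (\<delta> + 1 / t) * s"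
      using s by (simp only: abs_of_pos mult_pos_pos zero_less_numeral mult.commute mult.left_commute)
    moreover have "\<bar>n / s - 1 / real q\<bar> = \<bar>n - s / real q\<bar> / s"
      using s by (simp add: abs_div_pos diff_divide_distrib)
    ultimately show ?thesis using s by (simp only: pos_divide_le_eq)
  qed
  then show ?thesis unfolding r ti n_def s_def \<delta>_def .
qed

theorem corollary1p6:
  shows "\<forall>\<epsilon>::real. \<epsilon> > 0 \<longrightarrow> (\<exists>C::real. C > 0 \<and>
    (\<forall>(N::nat) (q::nat) (a::int) (S::int set).
      N > 0 \<longrightarrow> q > 0 \<longrightarrow> sidon S \<longrightarrow> S \<subseteq> {1..int N} \<longrightarrow>
      real (card S) \<ge> 1 / 100 * real N powr (1/2) \<longrightarrow>
      \<bar>expect S (indicator (arith_prog (int q) a)) - inverse (real q)\<bar>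
        \<le> C * real N powr \<epsilon> *
          (\<bar>real (card S) / real N powr (1/2) - 1\<bar> + real N powr (-1/6)) powr (1/2)))"
\<comment> \<open>The witness \<open>300\<close> is uniform in \<open>\<epsilon>\<close>: the
  exponent \<open>-1/4\<close> is relaxed to \<open>-1/6\<close>, and
  \<open>N^\<epsilon> \<ge> 1\<close>.\<close>
proof (intro allI impI exI[of _ 300] conjI)
  fix \<epsilon> :: real and N q :: nat and a :: int and S :: "int set"
  assume \<epsilon>: "\<epsilon> > 0" and N: "N > 0" and q: "q > 0"
    and S: "sidon S" "S \<subseteq> {1..int N}"
    and lower: "real (card S) \<ge> 1 / 100 * real N powr (1/2)"
  define \<delta> where "\<delta> = \<bar>real (card S) / real N powr (1/2) - 1\<bar>"
  have finS: "finite S" using S(2) finite_subset by blast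
  have N1: "real N powr \<epsilon> \<ge> 1" using N \<epsilon> by (simp add: ge_one_powr_ge_zero)
  have "\<bar>expect S (indicator (arith_prog (int q) a)) - inverse (real q)\<bar>
      = \<bar>real (card (S \<inter> arith_prog (int q) a)) / real (card S) - 1 / real q\<bar>"
    using finS by (simp add: expect_def inverse_eq_divide indicator_def sum_of_bool_eq Int_def)
  also have "\<dots> \<le> 300 * sqrt (\<delta> + real N powr (-1/4))"
    unfolding \<delta>_def by (rule sidon_equidistribution[OF S N q lower])
  also have "\<dots> \<le> 300 * sqrt (\<delta> + real N powr (-1/6))"
    using N by (intro mult_left_mono real_sqrt_le_mono add_left_mono powr_mono) auto
  also have "\<dots> = 300 * (\<delta> + real N powr (-1/6)) powr (1/2)"
    by (subst powr_half_sqrt) (auto simp: \<delta>_def)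
  also have "\<dots> \<le> 300 * real N powr \<epsilon> * (\<delta> + real N powr (-1/6)) powr (1/2)"
    using N1 by (intro mult_right_mono) auto
  finally show "\<bar>expect S (indicator (arith_prog (int q) a)) - inverse (real q)\<bar>
      \<le> 300 * real N powr \<epsilon> *
        (\<bar>real (card S) / real N powr (1/2) - 1\<bar> + real N powr (-1/6)) powr (1/2)"
    unfolding \<delta>_def .
qed simp

end
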